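(* Let $f:\omega\to\omega$ be a permutation and let $F:2^\omega\to 2^\omega$ be its pullback, $F(A)(n)=A(f(n))$. If the set of $G\in 2^\omega$ such that $F(G)\le_{\mathrm T} G$ has positive Lebesgue measure, then $f$ is recursive.
   Context: Lebesgue measure on $2^\omega$ is the uniform (fair coin) product measure. *)

theory Defs
  imports "HOL-Probability.Probability"
begin

text \<open>
  Kleene's schemes for partial recursive functions relative to an oracle.  A program has no
  fixed arity; it denotes one partial function on argument lists of each length.
\<close>

datatype recf =
    Zero
  | Succ
  | Proj nat
  | Oracle
  | Comp recf "recf list"
  | PrimRec recf recf
  | Mu recf

text \<open>
  The first argument is the oracle, an element of Cantor space.  Composition is strict.
  \<open>Mu g\<close> is unbounded search: its value is the least \<open>y\<close> with \<open>g(y, xs) = 0\<close>, and it is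
  undefined unless \<open>g(z, xs)\<close> converges to a nonzero value for every \<open>z < y\<close>.
\<close>

primrec reval :: "(nat \<Rightarrow> bool) \<Rightarrow> recf \<Rightarrow> nat list \<Rightarrow> nat option" where
  "reval A Zero = (\<lambda>xs. Some 0)"
| "reval A Succ = (\<lambda>xs. case xs of [x] \<Rightarrow> Some (Suc x) | _ \<Rightarrow> None)"
| "reval A (Proj i) = (\<lambda>xs. if i < length xs then Some (xs ! i) else None)"
| "reval A Oracle = (\<lambda>xs. case xs of [x] \<Rightarrow> Some (if A x then 1 else 0) | _ \<Rightarrow> None)"
| "reval A (Comp g hs) = (\<lambda>xs.
     let ys = map (\<lambda>\<phi>. \<phi> xs) (map (reval A) hs)
     in if None \<in> set ys then None else reval A g (map the ys))"
| "reval A (PrimRec g h) = (\<lambda>xs. case xs of [] \<Rightarrow> None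
     | n # zs \<Rightarrow> rec_nat (reval A g zs)
                         (\<lambda>m r. Option.bind r (\<lambda>v. reval A h (m # v # zs))) n)"
| "reval A (Mu g) = (\<lambda>xs.
     if \<exists>y. reval A g (y # xs) = Some 0 \<and> (\<forall>z<y. \<exists>k. reval A g (z # xs) = Some (Suc k))
     then Some (LEAST y. reval A g (y # xs) = Some 0)
     else None)"

primrec oracle_free :: "recf \<Rightarrow> bool" where
  "oracle_free Zero \<longleftrightarrow> True"
| "oracle_free Succ \<longleftrightarrow> True"
| "oracle_free (Proj i) \<longleftrightarrow> True"
| "oracle_free Oracle \<longleftrightarrow> False"
| "oracle_free (Comp g hs) \<longleftrightarrow> oracle_free g \<and> list_all oracle_free hs"
| "oracle_free (PrimRec g h) \<longleftrightarrow> oracle_free g \<and> oracle_free h"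
| "oracle_free (Mu g) \<longleftrightarrow> oracle_free g"

text \<open>The oracle passed to \<open>reval\<close> here is irrelevant, as the program makes no oracle calls.\<close>

definition recursive :: "(nat \<Rightarrow> nat) \<Rightarrow> bool" where
  "recursive f \<longleftrightarrow> (\<exists>e. oracle_free e \<and> (\<forall>n. reval (\<lambda>_. False) e [n] = Some (f n)))"

definition turing_le :: "(nat \<Rightarrow> bool) \<Rightarrow> (nat \<Rightarrow> bool) \<Rightarrow> bool"  (infix \<open>\<le>\<^sub>T\<close> 50) where
  "B \<le>\<^sub>T A \<longleftrightarrow> (\<exists>e. \<forall>n. reval A e [n] = Some (if B n then 1 else 0))"

definition pullback :: "(nat \<Rightarrow> nat) \<Rightarrow> (nat \<Rightarrow> bool) \<Rightarrow> (nat \<Rightarrow> bool)" where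
  "pullback f A = (\<lambda>n. A (f n))"

definition cantor_measure :: "(nat \<Rightarrow> bool) measure" where
  "cantor_measure = PiM UNIV (\<lambda>_. measure_pmf (bernoulli_pmf (1/2)))"

instance recf :: countable
  by countable_datatype

lemma oracle_component [measurable]:
  "Measurable.pred cantor_measure (\<lambda>A. A x)"
  unfolding cantor_measure_def
  using measurable_component_singleton[of x UNIV "\<lambda>_::nat. measure_pmf (bernoulli_pmf (1/2))"]
  by simp

lemma reval_measurable:
  "(\<lambda>A. reval A e xs) \<in> cantor_measure \<rightarrow>\<^sub>M count_space UNIV"
proof (induction e arbitrary: xs)
  case Oracle
  consider (one) x where "xs = [x]" | (other) "\<And>A. reval A Oracle xs = None"
    by (cases xs rule: remdups_adj.cases) auto
  then show ?case by cases simp_all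
next
  case (Comp g hs)
  note [measurable] = Comp.IH(1)
  have "(\<lambda>A. map (\<lambda>h. reval A h xs) hs) \<in> cantor_measure \<rightarrow>\<^sub>M count_space UNIV"
    using Comp.IH(2)
  proof (induction hs)
    case (Cons h hs)
    have [measurable]: "(\<lambda>A. reval A h xs) \<in> cantor_measure \<rightarrow>\<^sub>M count_space UNIV"
      using Cons.prems by simp
    have [measurable]: "(\<lambda>A. map (\<lambda>h. reval A h xs) hs) \<in> cantor_measure \<rightarrow>\<^sub>M count_space UNIV"
      using Cons by simp
    show ?case by simp
  qed simp
  then have [measurable]:
    "(\<lambda>A. map (\<lambda>h. reval A h xs) hs) \<in> cantor_measure \<rightarrow>\<^sub>M count_space UNIV" .
  have "(\<lambda>A. (\<lambda>ys. if None \<in> set ys then None else reval A g (map the ys))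
      (map (\<lambda>h. reval A h xs) hs)) \<in> cantor_measure \<rightarrow>\<^sub>M count_space UNIV"
    by (rule measurable_compose_countable) measurable
  then show ?case by (simp add: o_def Let_def)
next
  case (PrimRec g h)
  note [measurable] = PrimRec.IH
  have "(\<lambda>A. rec_nat (reval A g zs) (\<lambda>m r. Option.bind r (\<lambda>v. reval A h (m # v # zs))) n)
      \<in> cantor_measure \<rightarrow>\<^sub>M count_space UNIV" for n zs
  proof (induction n)
    case (Suc n)
    have [measurable]: "(\<lambda>A. Option.bind r (\<lambda>v. reval A h (n # v # zs)))
        \<in> cantor_measure \<rightarrow>\<^sub>M count_space UNIV" for r
      by (cases r) auto
    show ?case
      by simp (rule measurable_compose_countable[OF _ Suc], measurable)
  qed simp
  then show ?case by (cases xs) auto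
next
  case (Mu g)
  note [measurable] = Mu.IH
  show ?case by simp
qed auto

text \<open>
  As \<open>emeasure\<close> vanishes off the \<open>\<sigma>\<close>-algebra, speaking of the measure of the following set is
  meaningful only because the set is measurable.
\<close>

lemma turing_le_measurable:
  "{G. pullback f G \<le>\<^sub>T G} \<in> sets cantor_measure"
proof -
  have [measurable]: "Measurable.pred cantor_measure (\<lambda>G. reval G e [n] = Some (if G (f n) then 1 else 0))"
    for e n
  proof -
    note [measurable] = reval_measurable[of e "[n]"]
    have "Measurable.pred cantor_measure
        (\<lambda>G. G (f n) \<and> reval G e [n] = Some 1 \<or> \<not> G (f n) \<and> reval G e [n] = Some 0)"
      by measurable
    then show ?thesis
      by (rule measurable_cong[THEN iffD1, rotated]) auto
  qed
  have "{G \<in> space cantor_measure. pullback f G \<le>\<^sub>T G} \<in> sets cantor_measure"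
    unfolding turing_le_def pullback_def by measurable
  then show ?thesis by (simp add: cantor_measure_def space_PiM)
qed

end

theory Submission
  imports Defs
begin

text \<open>
  By countable additivity a single program \<open>e\<close> computes \<open>F(G)\<close> from \<open>G\<close> for a set of \<open>G\<close> of
  positive measure, and by Lebesgue density this set has relative measure above \<open>7/8\<close> in some
  cylinder given by \<open>L\<close> bits.  If \<open>f n \<ge> L\<close>, then \<open>f n\<close> is the only \<open>m\<close> for which
  the output of \<open>e\<close> on input \<open>n\<close> equals \<open>G m\<close> with conditional probability above \<open>3/4\<close>,
  as distinct bits, one of them outside the cylinder's prefix, agree with probability \<open>1/2\<close>
  only.  A probability above \<open>3/4\<close> is confirmed by a finite count over binary strings of some
  length \<open>s\<close>, so \<open>f n\<close> is found by unbounded search, except for the finitely many \<open>n\<close>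
  with \<open>f n < L\<close>, which are tabulated.  No universal machine is needed: for the fixed program
  \<open>e\<close>, evaluation in which searches and oracle queries stay below \<open>s\<close> is primitive recursive
  in \<open>s\<close> and a binary code of the oracle.
\<close>

subsection \<open>Total recursive functions on argument lists\<close>

text \<open>Programs have no arity of their own, so \<open>k\<close> fixes one. Lists of other
  lengths are unconstrained, which lets \<open>total_recursive_cong\<close> replace \<open>F\<close>
  by any expression agreeing with it at length \<open>k\<close>.\<close>

definition total_recursive :: "nat \<Rightarrow> (nat list \<Rightarrow> nat) \<Rightarrow> bool" where
  "total_recursive k F \<longleftrightarrow>
    (\<exists>e. oracle_free e \<and> (\<forall>xs. length xs = k \<longrightarrow> reval (\<lambda>_. False) e xs = Some (F xs)))"

lemma total_recursive_cong:
  assumes "total_recursive k F" and "\<And>xs. length xs = k \<Longrightarrow> F xs = G xs"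
  shows "total_recursive k G"
  using assms unfolding total_recursive_def by auto

text \<open>A list of options without \<open>None\<close> is \<open>map Some ys\<close> for exactly
  one \<open>ys\<close>. This gives strict composition a relational form for both
  \<open>reval\<close> and \<open>feval\<close>.\<close>

lemma strict_list_eq_Some_iff:
  fixes zs :: "'a option list"
  shows "(if None \<in> set zs then None else \<phi> (map the zs)) = Some v \<longleftrightarrow>
    (\<exists>ys. zs = map Some ys \<and> \<phi> ys = Some v)"
proof (cases "None \<in> set zs")
  case False
  then have zs: "zs = map Some (map the zs)"
    by (induction zs) auto
  have "map the (map Some ys) = ys" for ys :: "'a list" by (simp add: o_def)
  then have "zs = map Some ys \<longleftrightarrow> ys = map the zs" for ys using zs by metis
  then show ?thesis using False by simp
qed auto

lemma reval_Comp_Some: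
  "reval A (Comp g hs) xs = Some v \<longleftrightarrow>
    (\<exists>ys. map (\<lambda>h. reval A h xs) hs = map Some ys \<and> reval A g ys = Some v)"
  using strict_list_eq_Some_iff[of "map (\<lambda>h. reval A h xs) hs" "reval A g"]
  by (simp only: reval.simps Let_def map_map o_def)

lemma total_recursive_comp:
  assumes "total_recursive (length Hs) G" and "\<And>H. H \<in> set Hs \<Longrightarrow> total_recursive k H"
  shows "total_recursive k (\<lambda>xs. G (map (\<lambda>H. H xs) Hs))"
proof -
  obtain g where g: "oracle_free g"
      "\<And>xs. length xs = length Hs \<Longrightarrow> reval (\<lambda>_. False) g xs = Some (G xs)"
    using assms(1) unfolding total_recursive_def by blast
  have "\<forall>H\<in>set Hs. \<exists>e. oracle_free e \<and>
      (\<forall>xs. length xs = k \<longrightarrow> reval (\<lambda>_. False) e xs = Some (H xs))"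
    using assms(2) unfolding total_recursive_def by blast
  then obtain p where p: "\<And>H. H \<in> set Hs \<Longrightarrow> oracle_free (p H)"
      "\<And>H xs. H \<in> set Hs \<Longrightarrow> length xs = k \<Longrightarrow> reval (\<lambda>_. False) (p H) xs = Some (H xs)"
    by metis
  have "reval (\<lambda>_. False) (Comp g (map p Hs)) xs = Some (G (map (\<lambda>H. H xs) Hs))"
    if len: "length xs = k" for xs
    unfolding reval_Comp_Some
    by (intro exI[of _ "map (\<lambda>H. H xs) Hs"]) (use len p(2) g(2) in auto)
  moreover have "oracle_free (Comp g (map p Hs))"
    using g(1) p(1) by (simp add: list_all_iff)
  ultimately show ?thesis unfolding total_recursive_def by blast
qed

lemma total_recursive_nth:
  "i < k \<Longrightarrow> total_recursive k (\<lambda>xs. xs ! i)"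
  unfolding total_recursive_def by (rule exI[of _ "Proj i"]) simp

lemma total_recursive_nth_tl:
  assumes "Suc i < k"
  shows "total_recursive k (\<lambda>xs. tl xs ! i)"
  by (rule total_recursive_cong[OF total_recursive_nth[OF assms]]) (use assms in \<open>simp add: nth_tl\<close>)

lemma total_recursive_Suc:
  assumes "total_recursive k F"
  shows "total_recursive k (\<lambda>xs. Suc (F xs))"
proof -
  have "total_recursive 1 (\<lambda>xs. Suc (xs ! 0))"
    unfolding total_recursive_def
    by (rule exI[of _ Succ]) (auto simp: length_Suc_conv)
  from total_recursive_comp[of "[F]" _ k, simplified, OF this[simplified] assms] show ?thesis by simp
qed

lemma total_recursive_const: "total_recursive k (\<lambda>xs. c)"
proof (induction c)
  case 0
  show ?case unfolding total_recursive_def by (rule exI[of _ Zero]) simp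
qed (rule total_recursive_Suc)

lemma map_nth_upt_drop:
  "map (\<lambda>i. xs ! (d + i)) [0..<length xs - d] = drop d xs"
  by (rule nth_equalityI) auto

text \<open>Weakening by projections: a function of the parameters stays recursive when a recursion
  puts its counter and accumulator in front of them.\<close>

lemma total_recursive_drop:
  assumes "total_recursive k F"
  shows "total_recursive (d + k) (\<lambda>xs. F (drop d xs))"
proof (rule total_recursive_cong)
  show "total_recursive (d + k) (\<lambda>xs. F (map (\<lambda>H. H xs) (map (\<lambda>i xs. xs ! (d + i)) [0..<k])))"
    by (rule total_recursive_comp) (use assms in \<open>auto intro: total_recursive_nth\<close>)
  show "F (map (\<lambda>H. H xs) (map (\<lambda>i xs. xs ! (d + i)) [0..<k])) = F (drop d xs)"
    if "length xs = d + k" for xs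
    using map_nth_upt_drop[of xs d] that by (simp add: o_def)
qed

lemma total_recursive_instantiate:
  assumes "total_recursive (j + k) F" and "length Hs = j" and "\<And>H. H \<in> set Hs \<Longrightarrow> total_recursive k H"
  shows "total_recursive k (\<lambda>xs. F (map (\<lambda>H. H xs) Hs @ xs))"
proof (rule total_recursive_cong)
  let ?Hs = "Hs @ map (\<lambda>i xs. xs ! i) [0..<k]"
  show "total_recursive k (\<lambda>xs. F (map (\<lambda>H. H xs) ?Hs))"
    by (rule total_recursive_comp) (use assms in \<open>auto intro: total_recursive_nth\<close>)
  show "F (map (\<lambda>H. H xs) ?Hs) = F (map (\<lambda>H. H xs) Hs @ xs)" if "length xs = k" for xs
    using map_nth_upt_drop[of xs 0] that by (simp add: o_def)
qed

text \<open>\<open>PrimRec\<close> recurses on its head argument;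
  \<open>total_recursive_instantiate\<close> then substitutes \<open>N xs\<close> for it. The
  closure lemmas below rewrite each operation as a \<open>rec_nat\<close> of this shape.\<close>

lemma total_recursive_rec_nat:
  assumes N: "total_recursive k N" and G: "total_recursive k G"
    and H: "total_recursive (2 + k) (\<lambda>ys. H (ys ! 0) (ys ! 1) (drop 2 ys))"
  shows "total_recursive k (\<lambda>xs. rec_nat (G xs) (\<lambda>m r. H m r xs) (N xs))"
proof -
  obtain g where g: "oracle_free g"
      "\<And>xs. length xs = k \<Longrightarrow> reval (\<lambda>_. False) g xs = Some (G xs)"
    using G unfolding total_recursive_def by blast
  obtain h where h: "oracle_free h"
      "\<And>ys. length ys = 2 + k \<Longrightarrow> reval (\<lambda>_. False) h ys = Some (H (ys ! 0) (ys ! 1) (drop 2 ys))"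
    using H unfolding total_recursive_def by blast
  have eval: "rec_nat (reval (\<lambda>_. False) g zs)
        (\<lambda>m r. Option.bind r (\<lambda>v. reval (\<lambda>_. False) h (m # v # zs))) n
      = Some (rec_nat (G zs) (\<lambda>m r. H m r zs) n)" if "length zs = k" for n zs
    using that by (induction n) (simp_all add: g h)
  have "total_recursive (1 + k) (\<lambda>xs. rec_nat (G (tl xs)) (\<lambda>m r. H m r (tl xs)) (hd xs))"
    unfolding total_recursive_def
    by (rule exI[of _ "PrimRec g h"]) (auto simp: g(1) h(1) eval length_Suc_conv)
  from total_recursive_instantiate[OF this, of "[N]"] N show ?thesis by simp
qed

section \<open>Arithmetic, comparisons and bounded sums\<close>

lemma total_recursive_add:
  assumes "total_recursive k F" "total_recursive k G"
  shows "total_recursive k (\<lambda>xs. F xs + G xs)"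
proof -
  have "rec_nat a (\<lambda>m r. Suc r) n = a + n" for a n by (induction n) auto
  moreover have "total_recursive k (\<lambda>xs. rec_nat (F xs) (\<lambda>m r. Suc r) (G xs))"
    by (intro total_recursive_rec_nat assms total_recursive_Suc total_recursive_nth) simp
  ultimately show ?thesis by simp
qed

lemma total_recursive_mult:
  assumes "total_recursive k F" "total_recursive k G"
  shows "total_recursive k (\<lambda>xs. F xs * G xs)"
proof -
  have "rec_nat 0 (\<lambda>m r. r + a) n = a * n" for a n :: nat by (induction n) auto
  moreover have "total_recursive k (\<lambda>xs. rec_nat 0 (\<lambda>m r. r + F xs) (G xs))"
    by (intro total_recursive_rec_nat assms total_recursive_add total_recursive_nth
        total_recursive_const total_recursive_drop) simp
  ultimately show ?thesis by simp
qed

lemma total_recursive_power: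
  assumes "total_recursive k F"
  shows "total_recursive k (\<lambda>xs. a ^ F xs)"
proof -
  have "rec_nat 1 (\<lambda>m r. a * r) n = a ^ n" for n by (induction n) auto
  moreover have "total_recursive k (\<lambda>xs. rec_nat 1 (\<lambda>m r. a * r) (F xs))"
    by (intro total_recursive_rec_nat assms total_recursive_mult total_recursive_nth
        total_recursive_const) simp
  ultimately show ?thesis by simp
qed

lemma total_recursive_pred:
  assumes "total_recursive k F"
  shows "total_recursive k (\<lambda>xs. F xs - 1)"
proof -
  have "rec_nat 0 (\<lambda>m r. m) n = n - 1" for n :: nat by (cases n) auto
  moreover have "total_recursive k (\<lambda>xs. rec_nat 0 (\<lambda>m r. m) (F xs))"
    by (intro total_recursive_rec_nat assms total_recursive_nth total_recursive_const) simp
  ultimately show ?thesis by simp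
qed

lemma total_recursive_diff:
  assumes "total_recursive k F" "total_recursive k G"
  shows "total_recursive k (\<lambda>xs. F xs - G xs)"
proof -
  have "rec_nat a (\<lambda>m r. r - 1) n = a - n" for a n :: nat by (induction n) auto
  moreover have "total_recursive k (\<lambda>xs. rec_nat (F xs) (\<lambda>m r. r - 1) (G xs))"
    by (intro total_recursive_rec_nat assms total_recursive_pred total_recursive_nth) simp
  ultimately show ?thesis by simp
qed

text \<open>Predicates enter through their 0/1 characteristic functions, so a case distinction is a
  sum of two products.\<close>

lemma total_recursive_if:
  assumes "total_recursive k (\<lambda>xs. of_bool (P xs))" "total_recursive k F" "total_recursive k G"
  shows "total_recursive k (\<lambda>xs. if P xs then F xs else G xs)"
proof (rule total_recursive_cong)
  show "total_recursive k (\<lambda>xs. of_bool (P xs) * F xs + (1 - of_bool (P xs)) * G xs)"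
    by (intro total_recursive_add total_recursive_mult total_recursive_diff total_recursive_const assms)
qed auto

lemma total_recursive_less:
  assumes "total_recursive k F" "total_recursive k G"
  shows "total_recursive k (\<lambda>xs. of_bool (F xs < G xs))"
proof (rule total_recursive_cong)
  \<comment> \<open>Truncated subtraction from 1, done twice, is the sign function.\<close>
  show "total_recursive k (\<lambda>xs. 1 - (1 - (G xs - F xs)))"
    by (intro total_recursive_diff total_recursive_const assms)
qed auto

lemma total_recursive_eq:
  assumes "total_recursive k F" "total_recursive k G"
  shows "total_recursive k (\<lambda>xs. of_bool (F xs = G xs))"
proof (rule total_recursive_cong)
  show "total_recursive k (\<lambda>xs. 1 - ((F xs - G xs) + (G xs - F xs)))"
    by (intro total_recursive_diff total_recursive_add total_recursive_const assms)
qed auto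

lemma total_recursive_conj:
  assumes "total_recursive k (\<lambda>xs. of_bool (P xs))" "total_recursive k (\<lambda>xs. of_bool (Q xs))"
  shows "total_recursive k (\<lambda>xs. of_bool (P xs \<and> Q xs))"
  using total_recursive_mult[OF assms] by (simp add: of_bool_conj)

lemma total_recursive_sum:
  assumes N: "total_recursive k N" and F: "total_recursive (Suc k) (\<lambda>ys. F (ys ! 0) (tl ys))"
  shows "total_recursive k (\<lambda>xs. \<Sum>i<N xs. F i xs)"
proof -
  have *: "rec_nat 0 (\<lambda>m r. r + F m xs) n = (\<Sum>i<n. F i xs)" for n xs by (induction n) auto
  \<comment> \<open>The summand reads the counter and the parameters, so the accumulator at position
    1 has to be skipped.\<close>
  have "total_recursive (2 + k) (\<lambda>xs. F (xs ! 0) (drop 2 xs))"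
  proof (rule total_recursive_cong)
    let ?Hs = "(\<lambda>xs. xs ! 0) # map (\<lambda>i xs. xs ! (2 + i)) [0..<k]"
    show "total_recursive (2 + k) (\<lambda>xs. F (map (\<lambda>H. H xs) ?Hs ! 0) (tl (map (\<lambda>H. H xs) ?Hs)))"
      by (rule total_recursive_comp) (use F in \<open>auto intro: total_recursive_nth\<close>)
    show "F (map (\<lambda>H. H xs) ?Hs ! 0) (tl (map (\<lambda>H. H xs) ?Hs)) = F (xs ! 0) (drop 2 xs)"
      if "length xs = 2 + k" for xs
      using map_nth_upt_drop[of xs 2] that by (simp add: o_def)
  qed
  then have "total_recursive k (\<lambda>xs. rec_nat 0 (\<lambda>m r. r + F m xs) (N xs))"
    by (intro total_recursive_rec_nat N total_recursive_const total_recursive_add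
        total_recursive_nth) simp_all
  then show ?thesis by (simp only: *)
qed

section \<open>Binary digits and finite tables\<close>

lemma total_recursive_mod2:
  assumes "total_recursive k F"
  shows "total_recursive k (\<lambda>xs. F xs mod 2)"
proof -
  have "rec_nat 0 (\<lambda>m r. 1 - r) n = n mod 2" for n :: nat
    by (induction n) (auto simp: mod_Suc)
  moreover have "total_recursive k (\<lambda>xs. rec_nat 0 (\<lambda>m r. 1 - r) (F xs))"
    by (intro total_recursive_rec_nat assms total_recursive_diff total_recursive_nth
        total_recursive_const) simp
  ultimately show ?thesis by simp
qed

lemma total_recursive_div2:
  assumes "total_recursive k F"
  shows "total_recursive k (\<lambda>xs. F xs div 2)"
proof -
  \<comment> \<open>Half of \<open>n\<close>, rounded down, is the number of odd \<open>m\<close>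
    below \<open>n\<close>.\<close>
  have "rec_nat 0 (\<lambda>m r. r + m mod 2) n = n div 2" for n :: nat
    by (induction n) (auto simp: div_Suc mod_Suc)
  moreover have "total_recursive k (\<lambda>xs. rec_nat 0 (\<lambda>m r. r + m mod 2) (F xs))"
    by (intro total_recursive_rec_nat assms total_recursive_add total_recursive_nth
        total_recursive_const total_recursive_mod2) simp_all
  ultimately show ?thesis by simp
qed

lemma total_recursive_drop_bit:
  assumes "total_recursive k F" "total_recursive k G"
  shows "total_recursive k (\<lambda>xs. drop_bit (F xs) (G xs))"
proof -
  have "rec_nat a (\<lambda>m r. r div 2) n = drop_bit n a" for a n :: nat
    by (induction n) (simp_all add: drop_bit_eq_div div_mult2_eq[symmetric] mult.commute)
  moreover have "total_recursive k (\<lambda>xs. rec_nat (G xs) (\<lambda>m r. r div 2) (F xs))"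
    by (intro total_recursive_rec_nat assms total_recursive_div2 total_recursive_nth) simp
  ultimately show ?thesis by simp
qed

lemma total_recursive_bit:
  assumes "total_recursive k F" "total_recursive k G"
  shows "total_recursive k (\<lambda>xs. of_bool (bit (G xs) (F xs)))"
proof -
  have "of_bool (bit a n) = drop_bit n a mod 2" for a n :: nat
    by (simp add: bit_iff_odd_drop_bit mod_2_eq_odd)
  moreover have "total_recursive k (\<lambda>xs. drop_bit (F xs) (G xs) mod 2)"
    by (intro assms total_recursive_mod2 total_recursive_drop_bit)
  ultimately show ?thesis by simp
qed

lemma total_recursive_take_bit:
  assumes "total_recursive k F"
  shows "total_recursive k (\<lambda>xs. take_bit L (F xs))"
proof -
  have "take_bit L a = a - 2 ^ L * drop_bit L a" for a :: nat
    by (simp add: take_bit_eq_mod drop_bit_eq_div minus_mult_div_eq_mod)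
  moreover have "total_recursive k (\<lambda>xs. F xs - 2 ^ L * drop_bit L (F xs))"
    by (intro assms total_recursive_diff total_recursive_mult total_recursive_const
        total_recursive_drop_bit)
  ultimately show ?thesis by simp
qed

text \<open>A finite table is a nested case distinction, whatever \<open>g\<close> is.\<close>

lemma total_recursive_finite_support:
  assumes "finite N" and "i < k"
  shows "total_recursive k (\<lambda>xs. if xs ! i \<in> N then g (xs ! i) else 0)"
  using assms(1)
proof induction
  case (insert a N)
  have "total_recursive k (\<lambda>xs. if xs ! i = a then g a else if xs ! i \<in> N then g (xs ! i) else 0)"
    by (intro total_recursive_if total_recursive_eq total_recursive_nth total_recursive_const
        insert.IH assms(2))
  then show ?case by (rule total_recursive_cong) auto
qed (simp add: total_recursive_const)

subsection \<open>Evaluation with bounded fuel\<close>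

text \<open>The bound \<open>s\<close> restricts only oracle queries and search results. Primitive
  recursion terminates by itself, so \<open>s\<close> is passed on unchanged and never counted
  down.\<close>

primrec feval :: "nat \<Rightarrow> (nat \<Rightarrow> bool) \<Rightarrow> recf \<Rightarrow> nat list \<Rightarrow> nat option" where
  "feval s A Zero = (\<lambda>xs. Some 0)"
| "feval s A Succ = (\<lambda>xs. case xs of [x] \<Rightarrow> Some (Suc x) | _ \<Rightarrow> None)"
| "feval s A (Proj i) = (\<lambda>xs. if i < length xs then Some (xs ! i) else None)"
| "feval s A Oracle = (\<lambda>xs. case xs of [x] \<Rightarrow> if x < s then Some (of_bool (A x)) else None | _ \<Rightarrow> None)"
| "feval s A (Comp g hs) = (\<lambda>xs.
     let ys = map (\<lambda>\<phi>. \<phi> xs) (map (feval s A) hs)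
     in if None \<in> set ys then None else feval s A g (map the ys))"
| "feval s A (PrimRec g h) = (\<lambda>xs. case xs of [] \<Rightarrow> None
     | n # zs \<Rightarrow> rec_nat (feval s A g zs)
                         (\<lambda>m r. Option.bind r (\<lambda>v. feval s A h (m # v # zs))) n)"
| "feval s A (Mu g) = (\<lambda>xs.
     if \<exists>y<s. feval s A g (y # xs) = Some 0 \<and> (\<forall>z<y. \<exists>k. feval s A g (z # xs) = Some (Suc k))
     then Some (LEAST y. feval s A g (y # xs) = Some 0)
     else None)"

section \<open>Bounded evaluation compared with true evaluation\<close>

lemma Least_search:
  assumes "p y = Some (0::nat)" and "\<And>z. z < y \<Longrightarrow> \<exists>k. p z = Some (Suc k)"
  shows "(LEAST y. p y = Some 0) = (y::nat)"
  by (rule Least_equality) (use assms in \<open>force simp: not_less[symmetric]\<close>)+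

lemma reval_Mu_Some:
  "reval A (Mu g) xs = Some v \<longleftrightarrow>
    reval A g (v # xs) = Some 0 \<and> (\<forall>z<v. \<exists>k. reval A g (z # xs) = Some (Suc k))"
  using Least_search[of "\<lambda>y. reval A g (y # xs)"] by auto

lemma feval_Mu_Some:
  "feval s A (Mu g) xs = Some v \<longleftrightarrow>
    v < s \<and> feval s A g (v # xs) = Some 0 \<and> (\<forall>z<v. \<exists>k. feval s A g (z # xs) = Some (Suc k))"
  using Least_search[of "\<lambda>y. feval s A g (y # xs)"] by auto

lemma feval_Comp_Some:
  "feval s A (Comp g hs) xs = Some v \<longleftrightarrow>
    (\<exists>ys. map (\<lambda>h. feval s A h xs) hs = map Some ys \<and> feval s A g ys = Some v)"
  using strict_list_eq_Some_iff[of "map (\<lambda>h. feval s A h xs) hs" "feval s A g"]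
  by (simp only: feval.simps Let_def map_map o_def)

text \<open>One induction gives both monotonicity in \<open>s\<close> and the use principle: a
  defined result has consulted only oracle bits below \<open>s\<close>.\<close>

lemma feval_mono:
  assumes "feval s A e xs = Some v" "s \<le> s'" "\<And>i. i < s \<Longrightarrow> A i = B i"
  shows "feval s' B e xs = Some v"
  using assms(1)
proof (induction e arbitrary: xs v)
  case Oracle
  then show ?case using assms(2,3) by (auto split: list.splits if_splits)
next
  case (Comp g hs)
  from Comp.prems obtain ys where ys: "map (\<lambda>h. feval s A h xs) hs = map Some ys"
    "feval s A g ys = Some v" unfolding feval_Comp_Some by blast
  have "map (\<lambda>h. feval s' B h xs) hs = map Some ys"
    using ys(1) Comp.IH(2) by (auto simp: list_eq_iff_nth_eq)
  then show ?case unfolding feval_Comp_Some using Comp.IH(1) ys(2) by blast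
next
  case (PrimRec g h)
  have "rec_nat (feval s' B g zs) (\<lambda>m r. Option.bind r (\<lambda>v. feval s' B h (m # v # zs))) n = Some w"
    if "rec_nat (feval s A g zs) (\<lambda>m r. Option.bind r (\<lambda>v. feval s A h (m # v # zs))) n = Some w"
    for n zs w
    using that by (induction n arbitrary: w) (auto simp: bind_eq_Some_conv PrimRec.IH)
  then show ?case using PrimRec.prems by (auto split: list.splits)
next
  case (Mu g)
  then show ?case unfolding feval_Mu_Some using assms(2) by (meson order_less_le_trans)
qed auto

lemma feval_cong:
  assumes "\<And>i. i < s \<Longrightarrow> A i = B i"
  shows "feval s A e xs = feval s B e xs"
proof (cases "feval s A e xs")
  case None
  then show ?thesis
    using feval_mono[of s B e xs _ s A] assms by (cases "feval s B e xs") auto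
next
  case (Some v)
  then show ?thesis using feval_mono[of s A e xs v s B] assms by simp
qed

lemma feval_sound:
  assumes "feval s A e xs = Some v"
  shows "reval A e xs = Some v"
  using assms
proof (induction e arbitrary: xs v)
  case (Comp g hs)
  from Comp.prems obtain ys where ys: "map (\<lambda>h. feval s A h xs) hs = map Some ys"
    "feval s A g ys = Some v" unfolding feval_Comp_Some by blast
  have "map (\<lambda>h. reval A h xs) hs = map Some ys"
    using ys(1) Comp.IH(2) by (auto simp: list_eq_iff_nth_eq)
  then show ?case unfolding reval_Comp_Some using Comp.IH(1) ys(2) by blast
next
  case (PrimRec g h)
  have "rec_nat (reval A g zs) (\<lambda>m r. Option.bind r (\<lambda>v. reval A h (m # v # zs))) n = Some w"
    if "rec_nat (feval s A g zs) (\<lambda>m r. Option.bind r (\<lambda>v. feval s A h (m # v # zs))) n = Some w"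
    for n zs w
    using that by (induction n arbitrary: w) (auto simp: bind_eq_Some_conv PrimRec.IH)
  then show ?case using PrimRec.prems by (auto split: list.splits)
next
  case (Mu g)
  then show ?case unfolding feval_Mu_Some reval_Mu_Some by blast
qed (auto split: list.splits if_splits)

text \<open>By monotonicity the maximum of finitely many bounds serves all computations at once.
  This is applied to the arguments of a composition and to the stages of a search.\<close>

lemma feval_uniform_fuel:
  assumes "finite I" and "\<And>i. i \<in> I \<Longrightarrow> \<exists>s v. feval s A (e i) (xs i) = Some v \<and> P i v"
  shows "\<exists>s. \<forall>i\<in>I. \<exists>v. feval s A (e i) (xs i) = Some v \<and> P i v"
  using assms
proof (induction I)
  case (insert a I)
  obtain s where s: "\<forall>i\<in>I. \<exists>v. feval s A (e i) (xs i) = Some v \<and> P i v"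
    using insert.IH insert.prems by blast
  obtain s' v where "feval s' A (e a) (xs a) = Some v" "P a v"
    using insert.prems by blast
  then have "\<forall>i\<in>insert a I. \<exists>v. feval (max s s') A (e i) (xs i) = Some v \<and> P i v"
    using s by (auto intro!: feval_mono[of s' A _ _ _ "max s s'" A])
      (metis feval_mono max.cobounded1)
  then show ?case by blast
qed simp

text \<open>A convergent computation makes finitely many queries and searches, so some bound exceeds
  them all.\<close>

lemma feval_complete:
  assumes "reval A e xs = Some v"
  shows "\<exists>s. feval s A e xs = Some v"
  using assms
proof (induction e arbitrary: xs v)
  case Oracle
  then obtain x where "xs = [x]" by (auto split: list.splits)
  with Oracle show ?case by (intro exI[of _ "Suc x"]) auto
next
  case (Comp g hs)
  from Comp.prems obtain ys where ys: "map (\<lambda>h. reval A h xs) hs = map Some ys"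
    "reval A g ys = Some v" unfolding reval_Comp_Some by blast
  obtain s1 where s1: "feval s1 A g ys = Some v" using Comp.IH(1) ys(2) by blast
  have len: "length ys = length hs" using ys(1) by (metis length_map)
  have "\<exists>s. \<forall>i\<in>{..<length hs}. \<exists>v. feval s A (hs ! i) xs = Some v \<and> v = ys ! i"
  proof (rule feval_uniform_fuel)
    fix i assume "i \<in> {..<length hs}"
    then have "reval A (hs ! i) xs = Some (ys ! i)" "hs ! i \<in> set hs"
      using ys(1) len by (auto simp: list_eq_iff_nth_eq)
    then show "\<exists>s v. feval s A (hs ! i) xs = Some v \<and> v = ys ! i" using Comp.IH(2) by blast
  qed simp
  then obtain s2 where s2: "\<And>i. i < length hs \<Longrightarrow> feval s2 A (hs ! i) xs = Some (ys ! i)" by auto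
  have "map (\<lambda>h. feval (max s1 s2) A h xs) hs = map Some ys"
    using feval_mono[OF s2] len by (auto simp: list_eq_iff_nth_eq)
  moreover have "feval (max s1 s2) A g ys = Some v" using s1 by (rule feval_mono) auto
  ultimately show ?case unfolding feval_Comp_Some by blast
next
  case (PrimRec g h)
  have "\<exists>s. rec_nat (feval s A g zs) (\<lambda>m r. Option.bind r (\<lambda>v. feval s A h (m # v # zs))) n = Some w"
    if "rec_nat (reval A g zs) (\<lambda>m r. Option.bind r (\<lambda>v. reval A h (m # v # zs))) n = Some w"
    for n zs w
    using that
  proof (induction n arbitrary: w)
    case 0
    then show ?case using PrimRec.IH(1) by simp
  next
    case (Suc n)
    let ?R = "\<lambda>s. rec_nat (feval s A g zs) (\<lambda>m r. Option.bind r (\<lambda>v. feval s A h (m # v # zs)))"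
    obtain u where u: "rec_nat (reval A g zs) (\<lambda>m r. Option.bind r (\<lambda>v. reval A h (m # v # zs))) n = Some u"
      "reval A h (n # u # zs) = Some w" using Suc.prems by (auto simp: bind_eq_Some_conv)
    obtain s1 where s1: "?R s1 n = Some u" using Suc.IH u(1) by blast
    obtain s2 where s2: "feval s2 A h (n # u # zs) = Some w" using PrimRec.IH(2) u(2) by blast
    \<comment> \<open>The partial recursion is itself an evaluation of \<open>PrimRec g h\<close>,
      so \<open>feval_mono\<close> applies to it.\<close>
    have "feval (max s1 s2) A (PrimRec g h) (n # zs) = Some u"
      by (rule feval_mono[of s1 A]) (use s1 in auto)
    moreover have "feval (max s1 s2) A h (n # u # zs) = Some w"
      using s2 by (rule feval_mono) auto
    ultimately have "?R (max s1 s2) (Suc n) = Some w" by simp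
    then show ?case by blast
  qed
  then show ?case using PrimRec.prems by (auto split: list.splits)
next
  case (Mu g)
  then have v: "reval A g (v # xs) = Some 0" "\<And>z. z < v \<Longrightarrow> \<exists>k. reval A g (z # xs) = Some (Suc k)"
    unfolding reval_Mu_Some by auto
  \<comment> \<open>The values before \<open>v\<close> need not be named; it suffices that they are
    defined and nonzero.\<close>
  have "\<exists>s. \<forall>i\<in>{..v}. \<exists>w. feval s A g (i # xs) = Some w \<and> (w = 0 \<longleftrightarrow> i = v)"
  proof (rule feval_uniform_fuel)
    fix i assume "i \<in> {..v}"
    then consider "i = v" | "i < v" by fastforce
    then show "\<exists>s w. feval s A g (i # xs) = Some w \<and> (w = 0 \<longleftrightarrow> i = v)"
    proof cases
      case 2
      then show ?thesis using v(2)[of i] Mu.IH by fastforce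
    qed (use v(1) Mu.IH in blast)
  qed simp
  then obtain s where s: "\<And>i. i \<le> v \<Longrightarrow> \<exists>w. feval s A g (i # xs) = Some w \<and> (w = 0 \<longleftrightarrow> i = v)"
    by (meson atMost_iff)
  \<comment> \<open>\<open>Suc v\<close> is needed because a bounded search only accepts results
    strictly below the bound.\<close>
  have eq: "feval (max s (Suc v)) A g (i # xs) = feval s A g (i # xs)" if "i \<le> v" for i
    using s[OF that] by (metis feval_mono max.cobounded1)
  have "feval s A g (v # xs) = Some 0" using s[of v] by simp
  moreover have "\<exists>k. feval s A g (z # xs) = Some (Suc k)" if "z < v" for z
    using s[of z] that by (auto simp: gr0_conv_Suc)
  ultimately show ?case unfolding feval_Mu_Some
    by (intro exI[of _ "max s (Suc v)"]) (simp add: eq)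
qed auto

section \<open>Bounded evaluation as a recursive function of numerical codes\<close>

definition code_option :: "nat option \<Rightarrow> nat" where
  "code_option r = (case r of None \<Rightarrow> 0 | Some v \<Rightarrow> Suc v)"

lemma code_option_simps [simp]: "code_option None = 0" "code_option (Some v) = Suc v"
  by (simp_all add: code_option_def)

text \<open>The oracle is given by the binary digits of a number. By \<open>feval_cong\<close> only
  the digits below the bound matter, so numbers below \<open>2 ^ s\<close> represent every oracle at
  bound \<open>s\<close>.\<close>

definition feval_code :: "recf \<Rightarrow> nat list \<Rightarrow> nat" where
  "feval_code e ys = code_option (feval (ys ! 0) (bit (ys ! 1)) e (drop 2 ys))"

text \<open>
  In the iteration \<open>R\<close>, state \<open>0\<close> means still searching, \<open>1\<close> that some value on
  the way was undefined, and \<open>y + 2\<close> that the search has stopped at \<open>y\<close>.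
\<close>

lemma bounded_search_rec_nat:
  fixes p :: "nat \<Rightarrow> nat option"
  defines "R \<equiv> rec_nat 0 (\<lambda>m r. if r = 0 then if code_option (p m) = 1 then m + 2
      else if code_option (p m) = 0 then 1 else 0 else r)"
  shows "R s - 1 = code_option (if \<exists>y<s. p y = Some 0 \<and> (\<forall>z<y. \<exists>k. p z = Some (Suc k))
     then Some (LEAST y. p y = Some 0) else None)"
proof -
  \<comment> \<open>Subtracting 1 at the end sends the states 0 and 1 to the code of
    \<open>None\<close> and \<open>y + 2\<close> to the code of \<open>Some y\<close>.\<close>
  have inv: "(R s = 0 \<and> (\<forall>z<s. \<exists>k. p z = Some (Suc k))) \<or>
     (R s = 1 \<and> (\<exists>y<s. p y = None \<and> (\<forall>z<y. \<exists>k. p z = Some (Suc k)))) \<or>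
     (\<exists>y<s. R s = y + 2 \<and> p y = Some 0 \<and> (\<forall>z<y. \<exists>k. p z = Some (Suc k)))"
  proof (induction s)
    case (Suc s)
    have step: "R (Suc s) = (if R s = 0 then if code_option (p s) = 1 then s + 2
      else if code_option (p s) = 0 then 1 else 0 else R s)" unfolding R_def by simp
    from Suc consider "R s = 0" "\<forall>z<s. \<exists>k. p z = Some (Suc k)"
      | y where "R s = 1" "y<s" "p y = None" "\<forall>z<y. \<exists>k. p z = Some (Suc k)"
      | y where "R s = y + 2" "y<s" "p y = Some 0" "\<forall>z<y. \<exists>k. p z = Some (Suc k)" by (elim disjE exE conjE) metis+
    then show ?case
    proof cases
      case 1
      consider "p s = None" | "p s = Some 0" | k where "p s = Some (Suc k)"
        by (metis not0_implies_Suc option.exhaust)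
      then show ?thesis using 1 step by cases (auto simp: less_Suc_eq)
    next
      case (2 y)
      then have "R (Suc s) = 1" "y < Suc s" using step by simp_all
      with 2 show ?thesis by (intro disjI2 disjI1 conjI exI[of _ y]) simp_all
    next
      case (3 y)
      then have "R (Suc s) = y + 2" "y < Suc s" using step by simp_all
      with 3 show ?thesis by (intro disjI2 exI[of _ y] conjI) simp_all
    qed
  qed (simp add: R_def)
  then consider "R s = 0" "\<forall>z<s. \<exists>k. p z = Some (Suc k)"
      | y where "R s = 1" "y<s" "p y = None" "\<forall>z<y. \<exists>k. p z = Some (Suc k)"
      | y where "R s = y + 2" "y<s" "p y = Some 0" "\<forall>z<y. \<exists>k. p z = Some (Suc k)" by (elim disjE exE conjE) metis+
  then show ?thesis
  proof cases
    case 1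
    then show ?thesis by fastforce
  next
    case 2
    \<comment> \<open>An undefined value blocks every later zero, and all values before it are
      nonzero.\<close>
    have "\<not> (\<exists>y<s. p y = Some 0 \<and> (\<forall>z<y. \<exists>k. p z = Some (Suc k)))"
      using 2(3,4) by (metis linorder_neqE_nat nat.distinct(1) option.distinct(1) option.inject)
    with 2(1) show ?thesis by simp
  next
    case 3
    with Least_search[of p y] show ?thesis by auto
  qed
qed

lemma total_recursive_prod_list:
  assumes "\<And>H. H \<in> set Hs \<Longrightarrow> total_recursive k H"
  shows "total_recursive k (\<lambda>xs. \<Prod>H\<leftarrow>Hs. H xs)"
  using assms by (induction Hs) (auto intro: total_recursive_const total_recursive_mult)

text \<open>Induction on the program for all arities at once, since \<open>PrimRec\<close> and
  \<open>Mu\<close> call their subprograms with other numbers of arguments. At an arity that a basic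
  program rejects, the function is constantly 0, the code of \<open>None\<close>.\<close>

lemma total_recursive_feval_code: "total_recursive (2 + k) (feval_code e)"
proof (induction e arbitrary: k)
  case Zero
  show ?case by (simp add: feval_code_def[abs_def] total_recursive_const)
next
  case Succ
  show ?case
  proof (cases "k = 1")
    case True
    show ?thesis
      by (rule total_recursive_cong[of _ "\<lambda>xs. Suc (Suc (xs ! 2))"],
          intro total_recursive_Suc total_recursive_nth)
        (auto simp: True feval_code_def length_Suc_conv numeral_3_eq_3)
  next
    case False
    show ?thesis
      by (rule total_recursive_cong[OF total_recursive_const[of _ 0]])
        (use False in \<open>auto simp: feval_code_def split: list.splits dest: arg_cong[of _ _ length]\<close>)
  qed
next
  case (Proj i)
  show ?case
  proof (cases "i < k")
    case True
    show ?thesis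
      by (rule total_recursive_cong[of _ "\<lambda>xs. Suc (xs ! (2 + i))"],
          intro total_recursive_Suc total_recursive_nth)
        (use True in \<open>auto simp: feval_code_def\<close>)
  next
    case False
    show ?thesis
      by (rule total_recursive_cong[OF total_recursive_const[of _ 0]])
        (use False in \<open>auto simp: feval_code_def\<close>)
  qed
next
  case Oracle
  show ?case
  proof (cases "k = 1")
    case True
    show ?thesis
      by (rule total_recursive_cong[of _ "\<lambda>xs. if xs ! 2 < xs ! 0 then Suc (of_bool (bit (xs ! 1) (xs ! 2))) else 0"],
          intro total_recursive_if total_recursive_less total_recursive_bit total_recursive_const
            total_recursive_Suc total_recursive_nth)
        (auto simp: True feval_code_def length_Suc_conv numeral_3_eq_3)
  next
    case False
    show ?thesis
      by (rule total_recursive_cong[OF total_recursive_const[of _ 0]])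
        (use False in \<open>auto simp: feval_code_def split: list.splits dest: arg_cong[of _ _ length]\<close>)
  qed
next
  case (Comp g hs)
  let ?Hs = "map feval_code hs"
  let ?args = "(\<lambda>xs. xs ! 0) # (\<lambda>xs. xs ! 1) # map (\<lambda>h xs. feval_code h xs - 1) hs"
  \<comment> \<open>Strictness: the product of the argument codes vanishes iff some argument is
    undefined. Otherwise subtracting 1 decodes each of them.\<close>
  have "total_recursive (2 + k) (\<lambda>xs. if (\<Prod>H\<leftarrow>?Hs. H xs) = 0 then 0
      else feval_code g (map (\<lambda>H. H xs) ?args))"
  proof (intro total_recursive_if total_recursive_eq total_recursive_const total_recursive_prod_list
      total_recursive_comp)
    show "total_recursive (2 + k) H" if "H \<in> set ?Hs" for H using that Comp.IH(2) by auto
    show "total_recursive (length ?args) (feval_code g)" using Comp.IH(1)[of "length hs"] by simp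
    show "total_recursive (2 + k) H" if "H \<in> set ?args" for H
      using that Comp.IH(2) by (auto intro!: total_recursive_nth total_recursive_pred[simplified])
  qed
  then show ?case
  proof (rule total_recursive_cong)
    fix xs :: "nat list"
    let ?ev = "\<lambda>h. feval (xs ! 0) (bit (xs ! 1)) h (drop 2 xs)"
    have 1: "(\<Prod>H\<leftarrow>?Hs. H xs) = 0 \<longleftrightarrow> None \<in> set (map ?ev hs)"
      by (force simp: prod_list_zero_iff feval_code_def code_option_def image_iff split: option.splits)
    have 2: "map (\<lambda>h. feval_code h xs - 1) hs = map the (map ?ev hs)" if "None \<notin> set (map ?ev hs)"
      using that by (auto simp: feval_code_def code_option_def image_iff split: option.splits)
    show "(if (\<Prod>H\<leftarrow>?Hs. H xs) = 0 then 0 else feval_code g (map (\<lambda>H. H xs) ?args))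
        = feval_code (Comp g hs) xs"
    proof (cases "None \<in> set (map ?ev hs)")
      case True
      then show ?thesis unfolding 1 by (auto simp: feval_code_def Let_def o_def)
    next
      case False
      have "feval_code g (map (\<lambda>H. H xs) ?args) =
          code_option (feval (xs ! 0) (bit (xs ! 1)) g (map (\<lambda>h. feval_code h xs - 1) hs))"
        by (simp add: feval_code_def[of g] o_def)
      with False show ?thesis unfolding 1 2[OF False] by (simp add: feval_code_def Let_def o_def)
    qed
  qed
next
  case (PrimRec g h)
  show ?case
  proof (cases k)
    case 0
    show ?thesis
      by (rule total_recursive_cong[OF total_recursive_const[of _ 0]]) (simp add: 0 feval_code_def)
  next
    case (Suc j)
    \<comment> \<open>The list holds bound, oracle and recursion argument, so the parameters start
      at 3; with counter and accumulator in front they start at 5.\<close>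
    let ?rest = "map (\<lambda>i xs. xs ! (3 + i)) [0..<j]"
    let ?gargs = "(\<lambda>xs. xs ! 0) # (\<lambda>xs. xs ! 1) # ?rest"
    let ?hargs = "(\<lambda>xs. xs ! 2) # (\<lambda>xs. xs ! 3) # (\<lambda>xs. xs ! 0) # (\<lambda>xs. xs ! 1 - 1) #
      map (\<lambda>i xs. xs ! (5 + i)) [0..<j]"
    \<comment> \<open>The accumulator \<open>r\<close> is the code of the previous result: 0
      propagates undefinedness, and \<open>r - 1\<close> is the value.\<close>
    let ?H = "\<lambda>m r xs. if r = 0 then 0 else feval_code h (xs ! 0 # xs ! 1 # m # (r - 1) # drop 3 xs)"
    have G: "total_recursive (2 + k) (\<lambda>xs. feval_code g (map (\<lambda>F. F xs) ?gargs))"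
      by (rule total_recursive_comp) (use PrimRec.IH(1)[of j] Suc in \<open>auto intro!: total_recursive_nth\<close>)
    have "total_recursive (2 + (2 + k)) (\<lambda>xs. if xs ! 1 = 0 then 0 else feval_code h (map (\<lambda>F. F xs) ?hargs))"
    proof (intro total_recursive_if total_recursive_eq total_recursive_const total_recursive_nth
        total_recursive_comp)
      show "total_recursive (length ?hargs) (feval_code h)" using PrimRec.IH(2)[of "2 + j"] by simp
      show "total_recursive (2 + (2 + k)) H" if "H \<in> set ?hargs" for H
        using that Suc by (auto intro!: total_recursive_nth total_recursive_pred[simplified])
    qed simp
    then have H: "total_recursive (2 + (2 + k)) (\<lambda>ys. ?H (ys ! 0) (ys ! 1) (drop 2 ys))"
    proof (rule total_recursive_cong)
      fix xs :: "nat list" assume "length xs = 2 + (2 + k)"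
      then have "map (\<lambda>F. F xs) ?hargs =
          drop 2 xs ! 0 # drop 2 xs ! 1 # xs ! 0 # (xs ! 1 - 1) # drop 3 (drop 2 xs)"
        using map_nth_upt_drop[of xs 5] Suc by (simp add: o_def)
      then show "(if xs ! 1 = 0 then 0 else feval_code h (map (\<lambda>F. F xs) ?hargs))
          = ?H (xs ! 0) (xs ! 1) (drop 2 xs)" by presburger
    qed
    have "total_recursive (2 + k) (\<lambda>xs. rec_nat (feval_code g (map (\<lambda>F. F xs) ?gargs))
        (\<lambda>m r. ?H m r xs) (xs ! 2))"
      by (rule total_recursive_rec_nat[OF total_recursive_nth G H]) (simp add: Suc)
    then show ?thesis
    proof (rule total_recursive_cong)
      fix xs :: "nat list" assume len: "length xs = 2 + k"
      then have gargs: "map (\<lambda>F. F xs) ?gargs = xs ! 0 # xs ! 1 # drop 3 xs"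
        using map_nth_upt_drop[of xs 3] Suc by (simp add: o_def)
      let ?R = "rec_nat (feval (xs ! 0) (bit (xs ! 1)) g (drop 3 xs))
        (\<lambda>m r. Option.bind r (\<lambda>v. feval (xs ! 0) (bit (xs ! 1)) h (m # v # drop 3 xs)))"
      have rec: "rec_nat (feval_code g (xs ! 0 # xs ! 1 # drop 3 xs)) (\<lambda>m r. ?H m r xs) n
          = code_option (?R n)" for n
      proof (induction n)
        case (Suc n)
        then show ?case by (cases "?R n") (simp_all add: feval_code_def)
      qed (simp add: feval_code_def)
      have "drop 2 xs = xs ! 2 # drop 3 xs"
        using len Suc Cons_nth_drop_Suc[of 2 xs] by (simp add: numeral_3_eq_3 numeral_2_eq_2)
      then have "feval_code (PrimRec g h) xs = code_option (?R (xs ! 2))"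
        by (simp add: feval_code_def)
      then show "rec_nat (feval_code g (map (\<lambda>F. F xs) ?gargs)) (\<lambda>m r. ?H m r xs) (xs ! 2)
          = feval_code (PrimRec g h) xs"
        unfolding gargs rec by simp
    qed
  qed
next
  case (Mu g)
  let ?args = "(\<lambda>xs. xs ! 2) # (\<lambda>xs. xs ! 3) # (\<lambda>xs. xs ! 0) # map (\<lambda>i xs. xs ! (4 + i)) [0..<k]"
  let ?p = "\<lambda>m xs. feval_code g (xs ! 0 # xs ! 1 # m # drop 2 xs)"
  \<comment> \<open>This is the step function of \<open>bounded_search_rec_nat\<close>: code 1
    stands for a zero of \<open>g\<close>, code 0 for an undefined value.\<close>
  let ?H = "\<lambda>m r xs. if r = 0 then if ?p m xs = 1 then m + 2
      else if ?p m xs = 0 then 1 else 0 else r"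
  have "total_recursive (2 + (2 + k)) (\<lambda>xs. feval_code g (map (\<lambda>F. F xs) ?args))"
    by (rule total_recursive_comp) (use Mu.IH[of "1 + k"] in \<open>auto intro!: total_recursive_nth\<close>)
  then have "total_recursive (2 + (2 + k)) (\<lambda>xs. ?p (xs ! 0) (drop 2 xs))"
  proof (rule total_recursive_cong)
    fix xs :: "nat list" assume "length xs = 2 + (2 + k)"
    then have "map (\<lambda>F. F xs) ?args =
        drop 2 xs ! 0 # drop 2 xs ! 1 # xs ! 0 # drop 2 (drop 2 xs)"
      using map_nth_upt_drop[of xs 4] by (simp add: o_def)
    then show "feval_code g (map (\<lambda>F. F xs) ?args) = ?p (xs ! 0) (drop 2 xs)" by presburger
  qed
  then have H: "total_recursive (2 + (2 + k)) (\<lambda>ys. ?H (ys ! 0) (ys ! 1) (drop 2 ys))"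
    by (intro total_recursive_if total_recursive_eq total_recursive_const total_recursive_nth
        total_recursive_add) simp_all
  have "total_recursive (2 + k) (\<lambda>xs. rec_nat 0 (\<lambda>m r. ?H m r xs) (xs ! 0) - 1)"
    by (intro total_recursive_pred total_recursive_rec_nat[OF total_recursive_nth total_recursive_const H])
      simp
  then show ?case
  proof (rule total_recursive_cong)
    fix xs :: "nat list" assume len: "length xs = 2 + k"
    have "?p m xs = code_option (feval (xs ! 0) (bit (xs ! 1)) g (m # drop 2 xs))" for m
      by (simp add: feval_code_def)
    then show "rec_nat 0 (\<lambda>m r. ?H m r xs) (xs ! 0) - 1 = feval_code (Mu g) xs"
      using bounded_search_rec_nat[of "\<lambda>m. feval (xs ! 0) (bit (xs ! 1)) g (m # drop 2 xs)" "xs ! 0"]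
      by (simp only: feval_code_def[of "Mu g"] feval.simps)
  qed
qed

text \<open>Every stage \<open>s\<close> with a nonzero value yields the same answer, so the first
  one found may be decoded.\<close>

lemma recursive_of_search:
  assumes V: "total_recursive 2 (\<lambda>xs. V (xs ! 0) (xs ! 1))"
    and range: "\<And>s n. V s n = 0 \<or> V s n = Suc (f n)" and total: "\<And>n. \<exists>s. V s n \<noteq> 0"
  shows "recursive f"
proof -
  obtain v where v: "oracle_free v"
      "\<And>xs. length xs = 2 \<Longrightarrow> reval (\<lambda>_. False) v xs = Some (V (xs ! 0) (xs ! 1) - 1)"
    using total_recursive_pred[OF V] unfolding total_recursive_def by blast
  \<comment> \<open>\<open>Mu\<close> looks for a zero, so the test is inverted.\<close>
  have "total_recursive 2 (\<lambda>xs. 1 - V (xs ! 0) (xs ! 1))"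
    by (intro total_recursive_diff total_recursive_const V)
  then obtain t where t: "oracle_free t"
      "\<And>xs. length xs = 2 \<Longrightarrow> reval (\<lambda>_. False) t xs = Some (1 - V (xs ! 0) (xs ! 1))"
    unfolding total_recursive_def by blast
  have "reval (\<lambda>_. False) (Comp v [Mu t, Proj 0]) [n] = Some (f n)" for n
  proof -
    define s where "s = (LEAST s. V s n \<noteq> 0)"
    have s: "V s n \<noteq> 0" using LeastI_ex[OF total[of n]] by (simp add: s_def)
    have least: "V z n = 0" if "z < s" for z using not_less_Least[of z] that by (auto simp: s_def)
    have "reval (\<lambda>_. False) (Mu t) [n] = Some s"
      unfolding reval_Mu_Some using s least by (simp add: t(2))
    then show ?thesis
      unfolding reval_Comp_Some
      by (intro exI[of _ "[s, n]"]) (use s range[of s n] in \<open>simp add: v(2) del: reval.simps(7)\<close>)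
  qed
  then show ?thesis unfolding recursive_def
    by (intro exI[of _ "Comp v [Mu t, Proj 0]"]) (simp add: v(1) t(1))
qed

subsection \<open>Lebesgue measure on Cantor space\<close>

interpretation cantor: prob_space cantor_measure
  unfolding cantor_measure_def by (intro prob_space_PiM measure_pmf.prob_space_axioms)

lemma space_cantor [simp]: "space cantor_measure = UNIV"
  by (simp add: cantor_measure_def space_PiM)

definition depends_below :: "nat \<Rightarrow> (nat \<Rightarrow> bool) set \<Rightarrow> bool" where
  "depends_below s C \<longleftrightarrow> (\<forall>G H. (\<forall>i<s. G i = H i) \<longrightarrow> (G \<in> C \<longleftrightarrow> H \<in> C))"

lemma depends_belowD:
  assumes "depends_below s C" "\<And>i. i < s \<Longrightarrow> G i = H i"
  shows "G \<in> C \<longleftrightarrow> H \<in> C"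
  using assms unfolding depends_below_def by blast

lemma depends_belowI:
  assumes "\<And>G H. (\<And>i. i < s \<Longrightarrow> G i = H i) \<Longrightarrow> G \<in> C \<longleftrightarrow> H \<in> C"
  shows "depends_below s C"
  using assms unfolding depends_below_def by blast

lemma depends_below_mono:
  assumes "depends_below s C" "s \<le> s'"
  shows "depends_below s' C"
  by (rule depends_belowI, rule depends_belowD[OF assms(1)]) (use assms(2) in simp)

lemma depends_below_Compl: "depends_below s C \<Longrightarrow> depends_below s (- C)"
  unfolding depends_below_def by blast

lemma depends_below_Un:
  assumes "depends_below s C" "depends_below s D"
  shows "depends_below s (C \<union> D)"
proof (rule depends_belowI)
  fix G H :: "nat \<Rightarrow> bool" assume eq: "\<And>i. i < s \<Longrightarrow> G i = H i"
  have "G \<in> C \<longleftrightarrow> H \<in> C" by (rule depends_belowD[OF assms(1)]) (rule eq)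
  moreover have "G \<in> D \<longleftrightarrow> H \<in> D" by (rule depends_belowD[OF assms(2)]) (rule eq)
  ultimately show "G \<in> C \<union> D \<longleftrightarrow> H \<in> C \<union> D" by blast
qed

text \<open>The prefix is coded by the lowest \<open>s\<close> binary digits of \<open>t\<close>.
  Higher digits are ignored, so the code is unique only among numbers below
  \<open>2 ^ s\<close>.\<close>

definition cylinder :: "nat \<Rightarrow> nat \<Rightarrow> (nat \<Rightarrow> bool) set" where
  "cylinder s t = {G. \<forall>i<s. G i = bit t i}"

lemma cylinder_measurable [measurable]: "cylinder s t \<in> sets cantor_measure"
proof -
  have "{G \<in> space cantor_measure. \<forall>i<s. G i = bit t i} \<in> sets cantor_measure"
    by measurable
  then show ?thesis by (simp add: cylinder_def)
qed

lemma measure_cylinder: "measure cantor_measure (cylinder s t) = (1/2) ^ s"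
proof -
  let ?coin = "measure_pmf (bernoulli_pmf (1/2))"
  \<comment> \<open>As the embedding of a finite product of singletons, a cylinder has the product
    of the coin probabilities as its measure.\<close>
  have "cylinder s t = prod_emb UNIV (\<lambda>_. ?coin) {..<s} (Pi\<^sub>E {..<s} (\<lambda>i. {bit t i}))"
    by (auto simp: cylinder_def prod_emb_iff PiE_iff)
  then have "emeasure cantor_measure (cylinder s t) = (\<Prod>i<s. emeasure ?coin {bit t i})"
    unfolding cantor_measure_def
    by (simp only:) (rule emeasure_PiM_emb, auto intro: measure_pmf.prob_space_axioms)
  also have "\<dots> = (\<Prod>i<s. ennreal (1/2))"
  proof (rule prod.cong[OF refl])
    show "emeasure ?coin {bit t i} = ennreal (1/2)" for i
      by (cases "bit t i") (simp_all add: emeasure_pmf_single)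
  qed
  also have "\<dots> = ennreal ((1/2) ^ s)"
    by (simp only: prod_constant card_lessThan ennreal_power)
  finally show ?thesis by (simp add: measure_eq_emeasure_eq_ennreal)
qed

lemma eq_if_bits_below_eq:
  fixes t u :: nat
  assumes "t < 2 ^ s" "u < 2 ^ s" "\<And>i. i < s \<Longrightarrow> bit t i = bit u i"
  shows "t = u"
proof -
  have "take_bit s t = take_bit s u"
    using assms(3) by (auto simp: bit_eq_iff bit_take_bit_iff)
  then show ?thesis using assms(1,2) by (simp add: take_bit_nat_eq_self_iff[THEN iffD2])
qed

lemma exists_code: "\<exists>t<2 ^ s. G \<in> cylinder s t"
proof (intro exI conjI)
  let ?t = "horner_sum of_bool 2 (map G [0..<s]) :: nat"
  show "?t < 2 ^ s" using horner_sum_bound[of "map G [0..<s]"] by simp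
  show "G \<in> cylinder s ?t" by (auto simp: cylinder_def bit_horner_sum_bit_iff)
qed

lemma depends_below_eq_UN_cylinder:
  assumes "depends_below s C"
  shows "C = (\<Union>t\<in>{t. t < 2 ^ s \<and> bit t \<in> C}. cylinder s t)"
proof -
  have "bit t \<in> C \<longleftrightarrow> G \<in> C" if "G \<in> cylinder s t" for t G
    by (rule depends_belowD[OF assms]) (use that in \<open>auto simp: cylinder_def\<close>)
  then show ?thesis using exists_code[of s] by blast
qed

lemma disjoint_family_cylinder: "disjoint_family_on (cylinder s) {t. t < 2 ^ s \<and> P t}"
  unfolding disjoint_family_on_def cylinder_def
  by (auto intro!: eq_if_bits_below_eq[of _ s])

lemma finite_below_power: "finite {t::nat. t < 2 ^ s \<and> P t}"
  by (rule finite_subset[of _ "{..<2^s}"]) auto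

lemma depends_below_measurable:
  assumes "depends_below s C"
  shows "C \<in> sets cantor_measure"
proof -
  have "(\<Union>t\<in>{t. t < 2 ^ s \<and> bit t \<in> C}. cylinder s t) \<in> sets cantor_measure"
    by (intro sets.finite_UN finite_below_power cylinder_measurable)
  then show ?thesis using depends_below_eq_UN_cylinder[OF assms] by simp
qed

text \<open>Reduces measure to counting: \<open>bit t\<close> is the prefix \<open>t\<close>
  followed by zeros and represents its whole cylinder. This makes probabilities accessible to a
  recursive test.\<close>

lemma measure_depends_below:
  assumes "depends_below s C"
  shows "measure cantor_measure C = card {t::nat. t < 2 ^ s \<and> bit t \<in> C} / 2 ^ s"
proof -
  have "measure cantor_measure C =
      measure cantor_measure (\<Union>t\<in>{t. t < 2 ^ s \<and> bit t \<in> C}. cylinder s t)"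
    using depends_below_eq_UN_cylinder[OF assms] by simp
  also have "\<dots> = (\<Sum>t\<in>{t. t < 2 ^ s \<and> bit t \<in> C}. measure cantor_measure (cylinder s t))"
    by (rule cantor.finite_measure_finite_Union)
      (use finite_below_power disjoint_family_cylinder in auto)
  finally show ?thesis by (simp add: measure_cylinder power_divide)
qed

section \<open>Approximation by clopen sets and Lebesgue density\<close>

lemma sets_cantor: "sets cantor_measure = sigma_sets UNIV (range (\<lambda>i. {G. G i}))"
proof
  show "sigma_sets UNIV (range (\<lambda>i. {G. G i})) \<subseteq> sets cantor_measure"
  proof -
    have "{G. G i} \<in> sets cantor_measure" for i
      using oracle_component[of i] by (simp add: pred_def)
    then show ?thesis using sets.sigma_sets_subset[of "range (\<lambda>i. {G. G i})" cantor_measure] by auto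
  qed
  have "{G. G i \<in> A} \<in> sigma_sets UNIV (range (\<lambda>i. {G. G i}))" for i A
  proof -
    have base: "{G. G i} \<in> sigma_sets UNIV (range (\<lambda>i. {G. G i}))"
      by (rule sigma_sets.Basic) (rule rangeI)
    have "{G. \<not> G i} = UNIV - {G. G i}" by auto
    then have neg: "{G. \<not> G i} \<in> sigma_sets UNIV (range (\<lambda>i. {G. G i}))"
      using sigma_sets.Compl[OF base] by simp
    have "{G. G i \<in> A} = (if True \<in> A then {G. G i} else {}) \<union> (if False \<in> A then {G. \<not> G i} else {})"
    proof (rule set_eqI)
      fix G show "G \<in> {G. G i \<in> A} \<longleftrightarrow>
          G \<in> (if True \<in> A then {G. G i} else {}) \<union> (if False \<in> A then {G. \<not> G i} else {})"
        by (cases "G i") simp_all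
    qed
    then show ?thesis using base neg by (simp add: sigma_sets_Un sigma_sets.Empty)
  qed
  then show "sets cantor_measure \<subseteq> sigma_sets UNIV (range (\<lambda>i. {G. G i}))"
    unfolding cantor_measure_def sets_PiM_single
    by (simp add: PiE_UNIV_domain) (rule sigma_sets_mono, auto)
qed

text \<open>Sets approximable in symmetric difference form a \<sigma>-algebra containing the
  generators. A countable union is first cut to a finite one at cost \<open>\<epsilon> / 2\<close>,
  which is then approximated at cost \<open>\<epsilon> / 2\<close>.\<close>

lemma approx_by_depends_below:
  assumes "S \<in> sets cantor_measure" and "\<epsilon> > 0"
  shows "\<exists>s C. depends_below s C \<and>
    measure cantor_measure (S - C) + measure cantor_measure (C - S) < \<epsilon>"
  using assms unfolding sets_cantor
proof (induction S arbitrary: \<epsilon> rule: sigma_sets.induct)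
  case (Basic S)
  then obtain i where "S = {G. G i}" by auto
  then have "depends_below (Suc i) S" by (auto simp: depends_below_def)
  then show ?case using Basic(2) by (intro exI[of _ "Suc i"] exI[of _ S]) simp
next
  case Empty
  then show ?case by (intro exI[of _ 0] exI[of _ "{}"]) (simp add: depends_below_def)
next
  case (Compl S)
  then obtain s C where C: "depends_below s C"
    "measure cantor_measure (S - C) + measure cantor_measure (C - S) < \<epsilon>" by blast
  have "(UNIV - S) - (- C) = C - S" "(- C) - (UNIV - S) = S - C" by auto
  then show ?case using C depends_below_Compl[OF C(1)]
    by (intro exI[of _ s] exI[of _ "- C"]) simp
next
  case (Union S)
  have S[measurable]: "S i \<in> sets cantor_measure" for i using Union(1) unfolding sets_cantor .
  let ?U = "\<lambda>n. \<Union>i<n. S i"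
  have fin: "\<exists>s C. depends_below s C \<and>
      measure cantor_measure (?U n - C) + measure cantor_measure (C - ?U n) < \<delta>" if "\<delta> > 0" for n \<delta>
    using that
  proof (induction n arbitrary: \<delta>)
    case 0
    then show ?case by (intro exI[of _ 0] exI[of _ "{}"]) (simp add: depends_below_def)
  next
    case (Suc n)
    obtain s C where C: "depends_below s C"
      "measure cantor_measure (?U n - C) + measure cantor_measure (C - ?U n) < \<delta> / 2"
      using Suc.IH[of "\<delta> / 2"] Suc.prems by auto
    obtain s' D where D: "depends_below s' D"
      "measure cantor_measure (S n - D) + measure cantor_measure (D - S n) < \<delta> / 2"
      using Union.IH[of "\<delta> / 2" n] Suc.prems by auto
    have [measurable]: "C \<in> sets cantor_measure" "D \<in> sets cantor_measure"
      using C(1) D(1) depends_below_measurable by auto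
    have "measure cantor_measure (?U (Suc n) - (C \<union> D)) \<le>
        measure cantor_measure ((?U n - C) \<union> (S n - D))"
      by (rule cantor.finite_measure_mono) (auto simp: less_Suc_eq)
    also have "\<dots> \<le> measure cantor_measure (?U n - C) + measure cantor_measure (S n - D)"
      by (rule measure_Un_le) auto
    finally have 1: "measure cantor_measure (?U (Suc n) - (C \<union> D)) \<le>
        measure cantor_measure (?U n - C) + measure cantor_measure (S n - D)" .
    have "measure cantor_measure ((C \<union> D) - ?U (Suc n)) \<le>
        measure cantor_measure ((C - ?U n) \<union> (D - S n))"
      by (rule cantor.finite_measure_mono) (auto simp: less_Suc_eq)
    also have "\<dots> \<le> measure cantor_measure (C - ?U n) + measure cantor_measure (D - S n)"
      by (rule measure_Un_le) auto
    finally have 2: "measure cantor_measure ((C \<union> D) - ?U (Suc n)) \<le>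
        measure cantor_measure (C - ?U n) + measure cantor_measure (D - S n)" .
    have "depends_below (max s s') (C \<union> D)"
      using C(1) D(1) by (auto intro!: depends_below_Un intro: depends_below_mono)
    with 1 2 C(2) D(2) show ?case
      by (intro exI[of _ "max s s'"] exI[of _ "C \<union> D"]) argo
  qed
  have "(\<lambda>n. measure cantor_measure (?U n)) \<longlonglongrightarrow> measure cantor_measure (\<Union>n. ?U n)"
  proof (rule cantor.finite_Lim_measure_incseq)
    show "range ?U \<subseteq> sets cantor_measure" by (intro image_subsetI) measurable
    show "incseq ?U" by (intro monoI UN_mono) auto
  qed
  moreover have "(\<Union>n. ?U n) = (\<Union>i. S i)" by blast
  ultimately have "(\<lambda>n. measure cantor_measure (?U n)) \<longlonglongrightarrow> measure cantor_measure (\<Union>i. S i)" by simp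
  then have "\<forall>\<^sub>F n in sequentially. measure cantor_measure (?U n) > measure cantor_measure (\<Union>i. S i) - \<epsilon> / 2"
    using Union.prems by (intro order_tendstoD(1)) auto
  then obtain n where n: "measure cantor_measure (?U n) > measure cantor_measure (\<Union>i. S i) - \<epsilon> / 2"
    by (auto simp: eventually_sequentially)
  obtain s C where C: "depends_below s C"
      "measure cantor_measure (?U n - C) + measure cantor_measure (C - ?U n) < \<epsilon> / 2"
    using fin[of "\<epsilon> / 2" n] Union.prems by auto
  have [measurable]: "C \<in> sets cantor_measure" using C(1) depends_below_measurable by auto
  have "measure cantor_measure ((\<Union>i. S i) - ?U n) =
      measure cantor_measure (\<Union>i. S i) - measure cantor_measure (?U n)"
    by (rule cantor.finite_measure_Diff) auto
  moreover have "measure cantor_measure ((\<Union>i. S i) - C) \<le>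
        measure cantor_measure (((\<Union>i. S i) - ?U n) \<union> (?U n - C))"
      by (rule cantor.finite_measure_mono) auto
  moreover have "measure cantor_measure (((\<Union>i. S i) - ?U n) \<union> (?U n - C)) \<le>
      measure cantor_measure ((\<Union>i. S i) - ?U n) + measure cantor_measure (?U n - C)"
    by (rule measure_Un_le) auto
  moreover have "measure cantor_measure (C - (\<Union>i. S i)) \<le> measure cantor_measure (C - ?U n)"
    by (rule cantor.finite_measure_mono) auto
  ultimately show ?case using C n by (intro exI[of _ s] exI[of _ C]) argo
qed

text \<open>A weak form of the density theorem. If no cylinder had density above
  \<open>\<delta>\<close>, neither would any clopen set, as a disjoint union of cylinders; but a
  close clopen approximation of \<open>S\<close> is mostly filled by \<open>S\<close>.\<close>

lemma exists_dense_cylinder: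
  assumes S: "S \<in> sets cantor_measure" and pos: "measure cantor_measure S > 0" and "\<delta> < 1"
  shows "\<exists>s t. t < 2 ^ s \<and>
    measure cantor_measure (S \<inter> cylinder s t) > \<delta> * measure cantor_measure (cylinder s t)"
proof (rule ccontr)
  assume "\<not> ?thesis"
  then have le: "measure cantor_measure (S \<inter> cylinder s t) \<le> \<delta> * measure cantor_measure (cylinder s t)"
    if "t < 2 ^ s" for s t using that by force
  \<comment> \<open>The argument below bounds
    \<open>(1 - \<delta>) * measure cantor_measure S\<close> by the measure of the symmetric
    difference, so half of it is a contradictory error.\<close>
  define \<epsilon> where "\<epsilon> = (1 - \<delta>) * measure cantor_measure S / 2"
  have "\<epsilon> > 0" using pos \<open>\<delta> < 1\<close> by (simp add: \<epsilon>_def)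
  \<comment> \<open>The whole space is the cylinder with the empty prefix, so the negated claim
    already forces this.\<close>
  have "\<delta> \<ge> 0"
    using order_trans[OF measure_nonneg le[of 0 0]] measure_cylinder[of 0 0] by simp
  obtain s C where C: "depends_below s C"
    "measure cantor_measure (S - C) + measure cantor_measure (C - S) < \<epsilon>"
    using approx_by_depends_below[OF S \<open>\<epsilon> > 0\<close>] by blast
  let ?I = "{t::nat. t < 2 ^ s \<and> bit t \<in> C}"
  note [measurable] = S depends_below_measurable[OF C(1)]
  have CU: "C = (\<Union>t\<in>?I. cylinder s t)" by (rule depends_below_eq_UN_cylinder[OF C(1)])
  have "S \<inter> C = (\<Union>t\<in>?I. S \<inter> cylinder s t)" using CU by auto
  then have "measure cantor_measure (S \<inter> C) = measure cantor_measure (\<Union>t\<in>?I. S \<inter> cylinder s t)" by simp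
  also have "\<dots> = (\<Sum>t\<in>?I. measure cantor_measure (S \<inter> cylinder s t))"
    by (rule cantor.finite_measure_finite_Union)
      (use finite_below_power disjoint_family_cylinder[of s "\<lambda>t. bit t \<in> C"] S in
        \<open>auto simp: disjoint_family_on_def\<close>)
  also have "\<dots> \<le> (\<Sum>t\<in>?I. \<delta> * measure cantor_measure (cylinder s t))"
    by (intro sum_mono le) auto
  also have "\<dots> = \<delta> * measure cantor_measure C"
    by (simp add: measure_depends_below[OF C(1)] measure_cylinder power_divide)
  finally have 1: "measure cantor_measure (S \<inter> C) \<le> \<delta> * measure cantor_measure C" .
  have 2: "measure cantor_measure S = measure cantor_measure (S \<inter> C) + measure cantor_measure (S - C)"
    by (subst cantor.finite_measure_Union[symmetric]) (auto intro: arg_cong[where f = "measure _"])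
  have 3: "measure cantor_measure C = measure cantor_measure (S \<inter> C) + measure cantor_measure (C - S)"
    by (subst cantor.finite_measure_Union[symmetric]) (auto intro: arg_cong[where f = "measure _"])
  have "(1 - \<delta>) * measure cantor_measure (S \<inter> C) \<le> \<delta> * measure cantor_measure (C - S)"
    using 1 unfolding 3 by (simp add: algebra_simps)
  also have "\<dots> \<le> measure cantor_measure (C - S)"
    using \<open>\<delta> < 1\<close> by (simp add: mult_left_le_one_le \<open>\<delta> \<ge> 0\<close>)
  finally have 4: "(1 - \<delta>) * measure cantor_measure (S \<inter> C) \<le> measure cantor_measure (C - S)" .
  have "(1 - \<delta>) * measure cantor_measure (S - C) \<le> measure cantor_measure (S - C)"
    using \<open>\<delta> < 1\<close> \<open>\<delta> \<ge> 0\<close> by (intro mult_left_le_one_le) auto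
  then have "(1 - \<delta>) * measure cantor_measure S \<le> measure cantor_measure (C - S) + measure cantor_measure (S - C)"
    using 4 unfolding 2 by (simp add: algebra_simps)
  then show False using C(2) \<open>\<epsilon> > 0\<close> unfolding \<epsilon>_def by (simp add: field_simps)
qed

text \<open>Flipping bit \<open>k\<close>, which lies outside the prefix, preserves the cylinder and
  exchanges equality with inequality of the two bits. Position \<open>m\<close> may lie inside the
  prefix.\<close>

lemma measure_cylinder_equal_bits:
  assumes "L \<le> k" "m \<noteq> k"
  shows "measure cantor_measure {G \<in> cylinder L c. G m = G k} = (1/2) ^ L / 2"
proof -
  let ?A = "{G \<in> cylinder L c. G m = G k}" and ?B = "{G \<in> cylinder L c. G m \<noteq> G k}"
  define s where "s = Suc (max k (max m L))"
  have dep: "depends_below s ?A" "depends_below s ?B"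
    by (auto simp: depends_below_def cylinder_def s_def less_Suc_eq_le)
  let ?I = "\<lambda>C. {t::nat. t < 2 ^ s \<and> bit t \<in> C}"
  have flip: "flip_bit k t < 2 ^ s" if "t < 2 ^ s" for t :: nat
  proof -
    have "take_bit s (flip_bit k t) = flip_bit k t"
    proof (rule bit_eqI)
      fix i
      have "bit t i \<longrightarrow> i < s" using that by (metis bit_take_bit_iff take_bit_nat_eq_self)
      then show "bit (take_bit s (flip_bit k t)) i = bit (flip_bit k t) i"
        by (auto simp: bit_take_bit_iff bit_flip_bit_iff s_def)
    qed
    then show ?thesis by (metis take_bit_nat_less_exp)
  qed
  have bits: "bit (flip_bit k t) i = (if i = k then \<not> bit t i else bit t i)" for t i :: nat
    by (auto simp: bit_flip_bit_iff)
  have "bij_betw (flip_bit k) (?I ?A) (?I ?B)"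
  proof (rule bij_betw_byWitness[where f' = "flip_bit k"])
    show "\<forall>t\<in>?I ?A. flip_bit k (flip_bit k t) = t" "\<forall>t\<in>?I ?B. flip_bit k (flip_bit k t) = t"
      by (simp_all add: bit_eq_iff bits)
    have cyl: "bit (flip_bit k t) \<in> cylinder L c \<longleftrightarrow> bit t \<in> cylinder L c" for t :: nat
      using assms(1) by (force simp: cylinder_def bits)
    show "flip_bit k ` ?I ?A \<subseteq> ?I ?B" "flip_bit k ` ?I ?B \<subseteq> ?I ?A"
      using flip assms(2) by (simp_all add: image_subset_iff cyl bits)
  qed
  then have "card (?I ?A) = card (?I ?B)" by (rule bij_betw_same_card)
  then have eq: "measure cantor_measure ?A = measure cantor_measure ?B"
    using dep by (simp only: measure_depends_below)
  have "measure cantor_measure ?A + measure cantor_measure ?B = measure cantor_measure (?A \<union> ?B)"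
    by (rule cantor.finite_measure_Union[symmetric]) (use dep depends_below_measurable in auto)
  also have "?A \<union> ?B = cylinder L c" by auto
  finally show ?thesis using eq by (simp add: measure_cylinder)
qed

subsection \<open>Recovering the permutation\<close>

definition reducing_set :: "recf \<Rightarrow> (nat \<Rightarrow> nat) \<Rightarrow> (nat \<Rightarrow> bool) set" where
  "reducing_set e f = {G. \<forall>n. reval G e [n] = Some (of_bool (G (f n)))}"

lemma reducing_set_measurable: "reducing_set e f \<in> sets cantor_measure"
proof -
  have [measurable]:
    "Measurable.pred cantor_measure (\<lambda>G. reval G e [n] = Some (of_bool (G (f n))))" for n
  proof -
    note [measurable] = reval_measurable[of e "[n]"]
    have "Measurable.pred cantor_measure
        (\<lambda>G. G (f n) \<and> reval G e [n] = Some 1 \<or> \<not> G (f n) \<and> reval G e [n] = Some 0)"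
      by measurable
    then show ?thesis by (rule measurable_cong[THEN iffD1, rotated]) auto
  qed
  have "{G \<in> space cantor_measure. \<forall>n. reval G e [n] = Some (of_bool (G (f n)))} \<in> sets cantor_measure"
    by measurable
  then show ?thesis by (simp add: reducing_set_def)
qed

text \<open>There are countably many programs, and a countable union of null sets is null.\<close>

lemma exists_uniform_reduction:
  assumes "emeasure cantor_measure {G. pullback f G \<le>\<^sub>T G} > 0"
  shows "\<exists>e. measure cantor_measure (reducing_set e f) > 0"
proof (rule ccontr)
  assume "\<not> ?thesis"
  then have "measure cantor_measure (reducing_set e f) = 0" for e
    by (metis measure_nonneg order_le_less)
  then have "reducing_set e f \<in> null_sets cantor_measure" for e
    using reducing_set_measurable by (simp add: null_sets_def cantor.emeasure_eq_measure)
  then have "(\<Union>e. reducing_set e f) \<in> null_sets cantor_measure"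
    by (rule null_sets_UN)
  moreover have "{G. pullback f G \<le>\<^sub>T G} = (\<Union>e. reducing_set e f)"
    by (auto simp: turing_le_def pullback_def reducing_set_def of_bool_def)
  ultimately show False using assms by (auto dest: null_setsD1)
qed

text \<open>Bounded evaluation makes this event clopen and increasing in \<open>s\<close>.\<close>

definition agreement :: "recf \<Rightarrow> nat \<Rightarrow> nat \<Rightarrow> nat \<Rightarrow> nat \<Rightarrow> nat \<Rightarrow> (nat \<Rightarrow> bool) set" where
  "agreement e L c n m s = {G \<in> cylinder L c. feval s G e [n] = Some (of_bool (G m))}"

lemma depends_below_agreement:
  assumes "m < s'" "L \<le> s'" "s \<le> s'"
  shows "depends_below s' (agreement e L c n m s)"
proof (rule depends_belowI)
  fix G H :: "nat \<Rightarrow> bool" assume eq: "\<And>i. i < s' \<Longrightarrow> G i = H i"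
  have "feval s G e [n] = feval s H e [n]"
    by (rule feval_cong) (use eq assms in simp)
  moreover have "G m = H m" using eq assms by simp
  moreover have "G \<in> cylinder L c \<longleftrightarrow> H \<in> cylinder L c" using eq assms by (simp add: cylinder_def)
  ultimately show "G \<in> agreement e L c n m s \<longleftrightarrow> H \<in> agreement e L c n m s"
    by (simp add: agreement_def)
qed

lemma agreement_measurable [measurable]: "agreement e L c n m s \<in> sets cantor_measure"
  by (rule depends_below_measurable[OF depends_below_agreement[of _ "max (Suc m) (max L s)"]]) auto

text \<open>The inequality says, with denominators cleared, that \<open>agreement\<close> fills more
  than 3/4 of the cylinder. The bounds on \<open>m\<close> and \<open>L\<close> ensure that strings
  of length \<open>s\<close> decide the event.\<close>

definition witnesses :: "recf \<Rightarrow> nat \<Rightarrow> nat \<Rightarrow> nat \<Rightarrow> nat \<Rightarrow> nat \<Rightarrow> bool" where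
  "witnesses e L c n m s \<longleftrightarrow> m < s \<and> L \<le> s \<and>
    3 * 2 ^ s < 4 * 2 ^ L * (\<Sum>t<2 ^ s. of_bool (take_bit L t = c \<and>
      feval_code e [s, t, n] = Suc (of_bool (bit t m))) :: nat)"

lemma witnesses_iff:
  assumes "c < 2 ^ L"
  shows "witnesses e L c n m s \<longleftrightarrow>
    m < s \<and> L \<le> s \<and> measure cantor_measure (agreement e L c n m s) > 3/4 * (1/2) ^ L"
proof (cases "m < s \<and> L \<le> s")
  case True
  let ?P = "\<lambda>t. take_bit L t = c \<and> feval_code e [s, t, n] = Suc (of_bool (bit t m))"
  have cyl: "bit t \<in> cylinder L c \<longleftrightarrow> take_bit L t = c" for t
  proof
    assume "bit t \<in> cylinder L c"
    then show "take_bit L t = c"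
      by (intro eq_if_bits_below_eq[of _ L]) (auto simp: cylinder_def assms bit_take_bit_iff)
  qed (auto simp: cylinder_def bit_take_bit_iff)
  have "code_option r = Suc v \<longleftrightarrow> r = Some v" for r v by (cases r) auto
  then have "{t. t < 2 ^ s \<and> bit t \<in> agreement e L c n m s} = {..<2 ^ s} \<inter> {t. ?P t}"
    by (auto simp: agreement_def cyl feval_code_def)
  then have "measure cantor_measure (agreement e L c n m s) = card ({..<2 ^ s} \<inter> {t. ?P t}) / 2 ^ s"
    using measure_depends_below[OF depends_below_agreement, of m s L s e c n] True by simp
  moreover have "(\<Sum>t<2 ^ s. of_bool (?P t)) = card ({..<2 ^ s} \<inter> {t. ?P t})"
    by (subst sum_of_bool_eq) auto
  moreover have "3 * 2 ^ s < 4 * 2 ^ L * k \<longleftrightarrow> real k / 2 ^ s > 3/4 * (1/2) ^ L" for k :: nat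
  proof -
    have "3 * 2 ^ s < 4 * 2 ^ L * k \<longleftrightarrow> real (3 * 2 ^ s) < real (4 * 2 ^ L * k)"
      by (rule of_nat_less_iff[symmetric])
    also have "\<dots> \<longleftrightarrow> real k / 2 ^ s > 3/4 * (1/2) ^ L"
      by (simp add: field_simps power_divide)
    finally show ?thesis .
  qed
  ultimately show ?thesis using True unfolding witnesses_def by simp
qed (auto simp: witnesses_def)

lemma total_recursive_witnesses:
  "total_recursive 3 (\<lambda>xs. of_bool (witnesses e L c (xs ! 2) (xs ! 0) (xs ! 1)))"
proof -
  \<comment> \<open>The arguments are \<open>m\<close>, \<open>s\<close>, \<open>n\<close>, preceded
    by the summation index \<open>t\<close>; hence the \<open>tl\<close>.\<close>
  have "total_recursive 4 (\<lambda>zs. feval_code e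
      (map (\<lambda>H. H zs) [\<lambda>zs. tl zs ! 1, \<lambda>zs. zs ! 0, \<lambda>zs. tl zs ! 2]))"
    by (rule total_recursive_comp)
      (use total_recursive_feval_code[of 1 e] in
        \<open>auto intro: total_recursive_nth total_recursive_nth_tl simp: numeral_3_eq_3\<close>)
  then have code: "total_recursive 4 (\<lambda>zs. feval_code e [tl zs ! 1, zs ! 0, tl zs ! 2])" by simp
  have le: "a \<le> b \<longleftrightarrow> a < Suc b" for a b :: nat by auto
  show ?thesis
    unfolding witnesses_def le
    by (intro total_recursive_conj total_recursive_less total_recursive_Suc total_recursive_mult
        total_recursive_const total_recursive_nth total_recursive_nth_tl total_recursive_power
        total_recursive_sum total_recursive_eq total_recursive_take_bit total_recursive_bit)
      (use code in simp_all)
qed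

text \<open>The stages increase to an event containing the reducing part of the cylinder, so by
  continuity from below their measures eventually pass the smaller threshold 3/4.\<close>

lemma witnesses_complete:
  assumes c: "c < 2 ^ L"
    and dense: "measure cantor_measure (reducing_set e f \<inter> cylinder L c) > 7/8 * (1/2) ^ L"
  shows "\<exists>s. witnesses e L c n (f n) s"
proof -
  let ?E = "agreement e L c n (f n)"
  have inc: "incseq ?E"
    by (intro monoI) (auto simp: agreement_def intro: feval_mono)
  have "reducing_set e f \<inter> cylinder L c \<subseteq> (\<Union>s. ?E s)"
    using feval_complete by (fastforce simp: agreement_def reducing_set_def)
  then have "measure cantor_measure (reducing_set e f \<inter> cylinder L c) \<le>
      measure cantor_measure (\<Union>s. ?E s)"
    by (intro cantor.finite_measure_mono) auto
  moreover have "7/8 * (1/2) ^ L \<ge> (3/4 * (1/2) ^ L :: real)" by simp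
  ultimately have "measure cantor_measure (\<Union>s. ?E s) > 3/4 * (1/2) ^ L"
    using dense by linarith
  moreover have "(\<lambda>s. measure cantor_measure (?E s)) \<longlonglongrightarrow> measure cantor_measure (\<Union>s. ?E s)"
    by (rule cantor.finite_Lim_measure_incseq) (use inc in auto)
  ultimately have "\<forall>\<^sub>F s in sequentially. measure cantor_measure (?E s) > 3/4 * (1/2) ^ L"
    by (intro order_tendstoD(1))
  moreover have "\<forall>\<^sub>F s in sequentially. f n < s \<and> L \<le> s"
    using eventually_gt_at_top eventually_ge_at_top by (rule eventually_conj)
  ultimately have "\<forall>\<^sub>F s in sequentially. witnesses e L c n (f n) s"
    unfolding witnesses_iff[OF c] by eventually_elim auto
  then show ?thesis by (auto simp: eventually_sequentially)
qed

text \<open>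
  If \<open>m \<noteq> f n\<close>, then on the cylinder the bits \<open>G m\<close> and \<open>G (f n)\<close> agree with conditional
  probability only \<open>1/2\<close>, whereas two events of conditional probability above \<open>3/4\<close> and \<open>7/8\<close>
  meet with conditional probability above \<open>5/8\<close>.
\<close>

lemma witnesses_sound:
  assumes c: "c < 2 ^ L"
    and dense: "measure cantor_measure (reducing_set e f \<inter> cylinder L c) > 7/8 * (1/2) ^ L"
    and "L \<le> f n" and wit: "witnesses e L c n m s"
  shows "m = f n"
proof (rule ccontr)
  assume "m \<noteq> f n"
  let ?E = "agreement e L c n m s" and ?S = "reducing_set e f \<inter> cylinder L c"
  let ?Q = "{G \<in> cylinder L c. G m = G (f n)}"
  note [measurable] = reducing_set_measurable[of e f]
  have "?E \<inter> ?S \<subseteq> ?Q"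
  proof
    fix G assume G: "G \<in> ?E \<inter> ?S"
    then have "reval G e [n] = Some (of_bool (G m))"
      by (auto simp: agreement_def intro: feval_sound)
    moreover have "reval G e [n] = Some (of_bool (G (f n)))"
      using G by (simp add: reducing_set_def)
    ultimately show "G \<in> ?Q" using G by (simp add: of_bool_eq_iff)
  qed
  \<comment> \<open>In this form the relative measure of \<open>?E\<close> is below 1/2 + 1/8,
    contradicting the threshold 3/4.\<close>
  then have sub: "?E \<subseteq> ?Q \<union> (cylinder L c - ?S)" by (auto simp: agreement_def)
  have [measurable]: "?Q \<in> sets cantor_measure"
    by (rule depends_below_measurable[of "max L (max (Suc m) (Suc (f n)))"])
      (auto simp: cylinder_def intro!: depends_belowI)
  have "measure cantor_measure ?E \<le> measure cantor_measure (?Q \<union> (cylinder L c - ?S))"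
    using sub by (intro cantor.finite_measure_mono) auto
  also have "\<dots> \<le> measure cantor_measure ?Q + measure cantor_measure (cylinder L c - ?S)"
    by (rule measure_Un_le) auto
  also have "\<dots> = (1/2) ^ L / 2 + ((1/2) ^ L - measure cantor_measure ?S)"
    using measure_cylinder_equal_bits[OF \<open>L \<le> f n\<close> \<open>m \<noteq> f n\<close>]
    by (subst cantor.finite_measure_Diff) (auto simp: measure_cylinder)
  finally have "measure cantor_measure ?E \<le> (1/2) ^ L / 2 + ((1/2) ^ L - measure cantor_measure ?S)" .
  moreover have "measure cantor_measure ?E > 3/4 * (1/2) ^ L"
    using wit unfolding witnesses_iff[OF c] by simp
  moreover have "(1/2) ^ L > (0::real)" by simp
  ultimately show False using dense by linarith
qed

theorem theorem6p1:
  fixes f :: "nat \<Rightarrow> nat"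
  assumes "bij f"
    and "emeasure cantor_measure {G. pullback f G \<le>\<^sub>T G} > 0"
  shows "recursive f"
proof -
  obtain e where "measure cantor_measure (reducing_set e f) > 0"
    using exists_uniform_reduction[OF assms(2)] by blast
  then obtain L c where c: "c < 2 ^ L" and
    dense: "measure cantor_measure (reducing_set e f \<inter> cylinder L c) > 7/8 * (1/2) ^ L"
    \<comment> \<open>Density 7/8 serves both directions with threshold 3/4: it exceeds 3/4, and its
      defect 1/8 added to 1/2 stays below 3/4.\<close>
    using exists_dense_cylinder[OF reducing_set_measurable, of e f "7/8"]
    by (auto simp: measure_cylinder)
  \<comment> \<open>For these \<open>n\<close> the bit \<open>G (f n)\<close> is constant on the
    cylinder, so agreement cannot identify \<open>f n\<close>; injectivity of \<open>f\<close> makes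
    them finitely many.\<close>
  define N where "N = {n. f n < L}"
  have "N = f -` {..<L}" by (auto simp: N_def)
  then have N: "finite N" using assms(1) by (simp add: finite_vimageI bij_is_inj)
  \<comment> \<open>At most one summand is nonzero, by soundness, so the sum reads off the unique
    witness without a further search.\<close>
  define V where "V s n = (if n \<in> N then Suc (f n)
      else \<Sum>m<s. Suc m * of_bool (witnesses e L c n m s))" for s n
  have V: "V s n = (if n \<in> N then Suc (f n)
      else Suc (f n) * of_bool (witnesses e L c n (f n) s))" for s n
  proof (cases "n \<in> N")
    case False
    have "(\<Sum>m<s. Suc m * of_bool (witnesses e L c n m s)) =
        (\<Sum>m<s. if m = f n then Suc (f n) * of_bool (witnesses e L c n (f n) s) else 0)"
      using witnesses_sound[OF c dense, of n] False by (intro sum.cong) (auto simp: N_def)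
    also have "\<dots> = Suc (f n) * of_bool (witnesses e L c n (f n) s)"
      \<comment> \<open>\<open>witnesses\<close> includes \<open>f n < s\<close>, so cutting the sum
        at \<open>s\<close> loses nothing.\<close>
      by (auto simp: witnesses_def)
    finally show ?thesis using False by (simp add: V_def)
  qed (simp add: V_def)
  show ?thesis
  proof (rule recursive_of_search)
    show "V s n = 0 \<or> V s n = Suc (f n)" for s n by (simp add: V)
    show "\<exists>s. V s n \<noteq> 0" for n using witnesses_complete[OF c dense, of n] by (auto simp: V)
    \<comment> \<open>Table entries are successors, so the value 0 is a recursive test for
      \<open>n \<notin> N\<close>.\<close>
    let ?T = "\<lambda>n. if n \<in> N then Suc (f n) else 0"
    have T: "total_recursive 2 (\<lambda>xs. ?T (xs ! 1))"
      by (rule total_recursive_finite_support[OF N]) simp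
    have W: "total_recursive (Suc 2) (\<lambda>ys. of_bool (witnesses e L c (tl ys ! 1) (ys ! 0) (tl ys ! 0)))"
      by (rule total_recursive_cong[of _ "\<lambda>xs. of_bool (witnesses e L c (xs ! 2) (xs ! 0) (xs ! 1))"])
        (use total_recursive_witnesses in \<open>simp_all add: nth_tl numeral_2_eq_2 numeral_3_eq_3\<close>)
    have "total_recursive 2 (\<lambda>xs. if ?T (xs ! 1) = 0
        then \<Sum>m<xs ! 0. Suc m * of_bool (witnesses e L c (xs ! 1) m (xs ! 0)) else ?T (xs ! 1))"
      by (intro total_recursive_if total_recursive_eq total_recursive_const T total_recursive_sum
          total_recursive_mult total_recursive_Suc total_recursive_nth W) simp_all
    then show "total_recursive 2 (\<lambda>xs. V (xs ! 0) (xs ! 1))"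
      by (rule total_recursive_cong) (simp add: V_def)
  qed
qed

end
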